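(* Let $\mathbb{F}$ be a field. The algebra of derivations of the Heisenberg algebra $\mathbf{H}_{\mathbb{F}}$, written as matrices acting on column coordinates in the ordered basis $(e_1,e_2,e_0)$, is $$\mathrm{Der}(\mathbf{H}_{\mathbb{F}})=\left\{\begin{pmatrix}\alpha+\Delta_{22}&\Delta_{12}&\gamma_1\\ 0&\Delta_{22}&\gamma_2\\ 0&\beta_2&\alpha\end{pmatrix}\;\middle|\;\alpha,\beta_2,\gamma_1,\gamma_2,\Delta_{12},\Delta_{22}\in\mathbb{F}\right\}.$$
   Context: $\mathbf{H}_{\mathbb{F}}$ is the 3-dimensional Heisenberg Lie algebra over $\mathbb{F}$ with basis $e_0,e_1,e_2$ and brackets $[e_0,e_2]=e_1$, $[e_0,e_1]=[e_1,e_2]=0$; equivalently, $\mathbf{H}_{\mathbb{F}}=\mathbb{F}^2\rtimes\mathbb{F}e_0$ with $\mathrm{ad}_{e_0}=\begin{pmatrix}0&1\\0&0\end{pmatrix}$ on $\mathbb{F}^2=\mathrm{span}(e_1,e_2)$. *)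

theory Defs
  imports "HOL-Analysis.Analysis"
begin

locale lie_algebra = vector_space scale
  for scale :: "'a::field \<Rightarrow> 'b::ab_group_add \<Rightarrow> 'b" +
  fixes bracket :: "'b \<Rightarrow> 'b \<Rightarrow> 'b"
  assumes linear_left: "Vector_Spaces.linear scale scale (\<lambda>x. bracket x y)"
    and linear_right: "Vector_Spaces.linear scale scale (\<lambda>y. bracket x y)"
    and alternating: "bracket x x = 0"
    and jacobi: "bracket x (bracket y z) + bracket y (bracket z x) + bracket z (bracket x y) = 0"
begin

definition derivations :: "('b \<Rightarrow> 'b) set" where
  "derivations = {D. Vector_Spaces.linear scale scale D \<and>
     (\<forall>x y. D (bracket x y) = bracket (D x) y + bracket x (D y))}"

end

text \<open>
  The Heisenberg algebra is realised on triples. The standard basis is read in the order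
  (e1, e2, e0), so that matrices with respect to the standard basis are matrices with respect
  to this ordered basis.
\<close>

definition e1 :: "'a::field ^ 3" where "e1 = axis 1 1"
definition e2 :: "'a::field ^ 3" where "e2 = axis 2 1"
definition e0 :: "'a::field ^ 3" where "e0 = axis 3 1"

text \<open>The bilinear alternating extension of [e0, e2] = e1, [e0, e1] = [e1, e2] = 0.\<close>

definition heisenberg_bracket :: "'a::field ^ 3 \<Rightarrow> 'a ^ 3 \<Rightarrow> 'a ^ 3" where
  "heisenberg_bracket x y = (x $ 3 * y $ 2 - x $ 2 * y $ 3) *s e1"

global_interpretation heisenberg: lie_algebra
  "(*s) :: 'a::field \<Rightarrow> 'a ^ 3 \<Rightarrow> 'a ^ 3" heisenberg_bracket
  by unfold_locales
    (auto simp: heisenberg_bracket_def e1_def axis_def vec_eq_iff algebra_simps)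

lemma heisenberg_basis:
  "vec.independent {e1, e2, e0 :: 'a::field ^ 3}"
  "vec.span {e1, e2, e0 :: 'a::field ^ 3} = UNIV"
  "card {e1, e2, e0 :: 'a::field ^ 3} = 3"
proof -
  have *: "{e1, e2, e0 :: 'a ^ 3} = cart_basis"
    by (auto simp: cart_basis_def e1_def e2_def e0_def UNIV_3)
  show "vec.independent {e1, e2, e0 :: 'a ^ 3}" "vec.span {e1, e2, e0 :: 'a ^ 3} = UNIV"
    unfolding * by (simp_all add: independent_cart_basis span_cart_basis)
  show "card {e1, e2, e0 :: 'a ^ 3} = 3"
    unfolding * by (simp add: card_cart_basis)
qed

lemma heisenberg_bracket_basis:
  "heisenberg_bracket e0 e2 = e1"
  "heisenberg_bracket e0 e1 = 0"
  "heisenberg_bracket e1 e2 = 0"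
  by (simp_all add: heisenberg_bracket_def e0_def e1_def e2_def axis_def vec_eq_iff)

end

theory Submission
  imports Defs
begin

text \<open>
  The bracket is \<open>\<omega> x y\<close> times \<open>e1\<close>, where \<open>\<omega>\<close> is the area form on the coordinates at \<open>e2\<close>
  and \<open>e0\<close>; in particular it ignores the central coordinate, that at \<open>e1\<close>. Since \<open>e1\<close> itself is
  the bracket of \<open>e0\<close> and \<open>e2\<close>, the Leibniz rule for this one pair determines the image of \<open>e1\<close>:
  it is \<open>e1\<close> times the trace of the map \<open>B\<close> induced on the quotient plane modulo \<open>e1\<close>. So the
  first column of the matrix of a derivation is forced. No condition on the other columns remains:
  their entries in the first row only add central elements, and
  \<open>\<omega> (B x) y + \<omega> x (B y) = trace B * \<omega> x y\<close> holds for every endomorphism \<open>B\<close> of the plane.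
\<close>

lemma heisenberg_derivation_matrix_iff:
  fixes A :: "'a::field ^ 3 ^ 3"
  shows "(*v) A \<in> heisenberg.derivations \<longleftrightarrow>
    A $ 1 $ 1 = A $ 3 $ 3 + A $ 2 $ 2 \<and> A $ 2 $ 1 = 0 \<and> A $ 3 $ 1 = 0"
    (is "?der \<longleftrightarrow> ?col")
proof
  assume ?der
  then have "A *v heisenberg_bracket e0 e2 =
      heisenberg_bracket (A *v e0) e2 + heisenberg_bracket e0 (A *v e2)"
    by (simp add: heisenberg.derivations_def)
  then show ?col
    by (simp add: heisenberg_bracket_def e0_def e1_def e2_def axis_def vec_eq_iff
        forall_3 sum_3 matrix_vector_mult_def)
next
  assume ?col
  then have "A *v heisenberg_bracket x y =
      heisenberg_bracket (A *v x) y + heisenberg_bracket x (A *v y)" for x y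
    by (simp add: heisenberg_bracket_def e1_def axis_def vec_eq_iff
        forall_3 sum_3 matrix_vector_mult_def algebra_simps)
  then show ?der
    by (simp add: heisenberg.derivations_def matrix_vector_mul_linear_gen)
qed

lemma matrix_image_heisenberg_derivations:
  "matrix ` (heisenberg.derivations :: ('a::field ^ 3 \<Rightarrow> 'a ^ 3) set) =
    {A. (*v) A \<in> heisenberg.derivations}"
proof (intro equalityI subsetI)
  fix A :: "'a ^ 3 ^ 3"
  assume "A \<in> matrix ` heisenberg.derivations"
  then obtain D :: "'a ^ 3 \<Rightarrow> 'a ^ 3" where D: "D \<in> heisenberg.derivations" "A = matrix D"
    by blast
  then have "(*v) A = D"
    by (auto simp: heisenberg.derivations_def matrix_works)
  with D show "A \<in> {A. (*v) A \<in> heisenberg.derivations}"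
    by simp
next
  fix A :: "'a ^ 3 ^ 3"
  assume "A \<in> {A. (*v) A \<in> heisenberg.derivations}"
  then show "A \<in> matrix ` heisenberg.derivations"
    by (metis image_eqI matrix_of_matrix_vector_mul mem_Collect_eq)
qed

theorem proposition12:
  "matrix ` (heisenberg.derivations :: ('a::field ^ 3 \<Rightarrow> 'a ^ 3) set) =
    {vector [vector [\<alpha> + \<Delta>\<^sub>2\<^sub>2, \<Delta>\<^sub>1\<^sub>2, \<gamma>\<^sub>1],
             vector [0, \<Delta>\<^sub>2\<^sub>2, \<gamma>\<^sub>2],
             vector [0, \<beta>\<^sub>2, \<alpha>]] :: 'a ^ 3 ^ 3 | \<alpha> \<beta>\<^sub>2 \<gamma>\<^sub>1 \<gamma>\<^sub>2 \<Delta>\<^sub>1\<^sub>2 \<Delta>\<^sub>2\<^sub>2. True}"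
  unfolding matrix_image_heisenberg_derivations heisenberg_derivation_matrix_iff
  by (auto simp: vec_eq_iff forall_3)

end
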